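(* Assume $p_{12}p_{21}\neq1$, $m_{12}<\mathrm{ord}(p_{11})-1$ (so $p_{11}^{m_{12}}p_{12}p_{21}=1$) and $m_{21}<\mathrm{ord}(p_{22})-1$ (so $p_{22}^{m_{21}}p_{12}p_{21}=1$), with $\mathrm{ord}(p_{11})$ and $\mathrm{ord}(p_{22})$ finite. Then, for integers $m\ge0$ and $l$: (i) $\overline{l}_{1}^{m}[2]^-=0$ if $m\ge m_{12}+\mathrm{ord}(p_{11})$; $\overline{l}_{2}^{m}[1]^-=0$ if $m\ge m_{21}+\mathrm{ord}(p_{22})$. (ii) $\overline{l}_{1}^{m}[2]^-\neq0$ if $m<\mathrm{ord}(p_{11})$; $\overline{l}_{2}^{m}[1]^-\neq0$ if $m<\mathrm{ord}(p_{22})$. (iii) For $0\le l<m_{12}$: $\overline{l}_{1}^{\,\mathrm{ord}(p_{11})+l}[2]^-=0$ if and only if $\alpha_{k,l}^{l+1}=0$ for all $k=0,1,\dots,m_{12}-l-1$. For $0\le l<m_{21}$: $\overline{l}_{2}^{\,\mathrm{ord}(p_{22})+l}[1]^-=0$ if and only if $\bar\alpha_{k,l}^{l+1}=0$ for all $k=0,1,\dots,m_{21}-l-1$.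
   Context: $F$ is an algebraically closed field of characteristic zero. $V$ is a braided vector space of diagonal type with basis $x_1,x_2,\dots,x_n$ ($n\ge2$) and braiding $C(x_i\otimes x_j)=p_{ij}\,x_j\otimes x_i$, $p_{ij}\in F\setminus\{0\}$; $\mathfrak B(V)$ is its Nichols algebra. $\mathrm{ord}(q)$ is the multiplicative order of $q$. For $\{i,j\}=\{1,2\}$, $m_{ij}$ is the minimum of the $m\in\mathbb N_0$ such that $p_{ii}^mp_{ij}p_{ji}=1$, or $p_{ii}^{m+1}=1$ and $p_{ii}\neq1$. Iterated commutators in $\mathfrak B(V)$: with $[x,y]^-=yx-xy$, put $\overline l_i^{0}[j]^-=x_j$ and $\overline l_i^{m}[j]^-=[x_i,\overline l_i^{m-1}[j]^-]^-$ for $m\ge1$. Scalars: for $0\le l<m_{12}$ put $\alpha_{m,l}^{0}=(p_{11}^mp_{12}-1)^{\mathrm{ord}(p_{11})+l}$ for $0\le m\le m_{12}$, and $\alpha_{m,l}^{i+1}=\alpha_{m,l}^{i}-p_{11}^{-i}\alpha_{m+1,l}^{i}$ for $0\le i\le l$ and $0\le m\le m_{12}-i-1$. For $0\le l<m_{21}$ put $\bar\alpha_{m,l}^{0}=(p_{22}^mp_{21}-1)^{\mathrm{ord}(p_{22})+l}$ for $0\le m\le m_{21}$, and $\bar\alpha_{m,l}^{i+1}=\bar\alpha_{m,l}^{i}-p_{22}^{-i}\bar\alpha_{m+1,l}^{i}$ for $0\le i\le l$ and $0\le m\le m_{21}-i-1$. *)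

theory Defs
  imports "HOL-Algebra.QuotRing" "HOL-Computational_Algebra.Polynomial"
begin

(* The tensor algebra T(V) of the space V with basis x_1, ..., x_n.  A tensor is given by its
   coefficients with respect to the basis of words: the word [i_1, ..., i_d] over {1..n} stands
   for the tensor product of x_{i_1}, ..., x_{i_d}. *)

definition tensor_algebra :: "nat \<Rightarrow> (nat list \<Rightarrow> 'a::field) ring" where
  "tensor_algebra n =
    \<lparr>carrier = {f. finite {w. f w \<noteq> 0} \<and> {w. f w \<noteq> 0} \<subseteq> lists {1..n}},
     monoid.mult = (\<lambda>f g w. \<Sum>k\<le>length w. f (take k w) * g (drop k w)),
     one = (\<lambda>w. if w = [] then 1 else 0),
     ring.zero = (\<lambda>w. 0),
     add = (\<lambda>f g w. f w + g w)\<rparr>"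

definition basis_tensor :: "nat list \<Rightarrow> nat list \<Rightarrow> 'a::field" where
  "basis_tensor u = (\<lambda>w. if w = u then 1 else 0)"

lemma mult_basis_tensor:
  "basis_tensor u \<otimes>\<^bsub>tensor_algebra n\<^esub> basis_tensor v = basis_tensor (u @ v)"
proof
  fix w :: "nat list"
  have "(\<Sum>k\<le>length w. basis_tensor u (take k w) * basis_tensor v (drop k w))
      = (\<Sum>k\<le>length w. if k = length u then of_bool (w = u @ v) else (0::'a))"
  proof (rule sum.cong)
    fix k assume "k \<in> {..length w}"
    then have "take k w = u \<and> drop k w = v \<longleftrightarrow> k = length u \<and> w = u @ v"
      by (metis append_eq_conv_conj append_take_drop_id atMost_iff length_take min.absorb2)
    then show "basis_tensor u (take k w) * basis_tensor v (drop k w)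
      = (if k = length u then of_bool (w = u @ v) else (0::'a))"
      by (auto simp: basis_tensor_def)
  qed simp
  also have "\<dots> = basis_tensor (u @ v) w"
    by (auto simp: basis_tensor_def)
  finally show "(basis_tensor u \<otimes>\<^bsub>tensor_algebra n\<^esub> basis_tensor v) w
      = (basis_tensor (u @ v) w :: 'a)"
    by (simp add: tensor_algebra_def)
qed

(* The braiding C(x_i, x_j) = p_ij x_j x_i applied to the tensor factors at the (0-based)
   positions k and k+1.  On coefficient functions, the coefficient of w comes from the word u
   obtained from w by exchanging these two letters, so u ! k = w ! Suc k and u ! Suc k = w ! k;
   see braid_basis_tensor for the action on the basis. *)

definition swap_letters :: "nat \<Rightarrow> nat list \<Rightarrow> nat list" where
  "swap_letters k w = w[k := w ! Suc k, Suc k := w ! k]"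

definition braid ::
  "(nat \<Rightarrow> nat \<Rightarrow> 'a::field) \<Rightarrow> nat \<Rightarrow> (nat list \<Rightarrow> 'a) \<Rightarrow> nat list \<Rightarrow> 'a" where
  "braid p k f = (\<lambda>w. if Suc k < length w
     then p (w ! Suc k) (w ! k) * f (swap_letters k w) else f w)"

lemma swap_letters_swap_letters:
  "Suc k < length w \<Longrightarrow> swap_letters k (swap_letters k w) = w"
  by (rule nth_equalityI) (auto simp: swap_letters_def nth_list_update)

lemma braid_basis_tensor:
  assumes "Suc k < length u"
  shows "braid p k (basis_tensor u)
    = (\<lambda>w. p (u ! k) (u ! Suc k) * basis_tensor (swap_letters k u) w)"
proof
  fix w
  show "braid p k (basis_tensor u) w
    = p (u ! k) (u ! Suc k) * basis_tensor (swap_letters k u) w"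
  proof (cases "w = swap_letters k u")
    case True
    with assms have "Suc k < length w" "swap_letters k w = u" "w ! k = u ! Suc k" "w ! Suc k = u ! k"
      using swap_letters_swap_letters[OF assms]
      by (simp_all add: swap_letters_def[of k u] nth_list_update)
    with True show ?thesis
      by (simp add: braid_def basis_tensor_def)
  next
    case False
    then have "\<not> (Suc k < length w \<and> swap_letters k w = u)"
      using swap_letters_swap_letters[of k w] by auto
    with False assms show ?thesis
      by (auto simp: braid_def basis_tensor_def)
  qed
qed

(* The quantum symmetrizer S_d: the sum of the lifts T_s of all s in the symmetric group on d
   letters to the braid group, acting through C, written in its standard factorization
     S_d = (S_{d-1} (x) id) (id + C_{d-1} + C_{d-1} C_{d-2} + ... + C_{d-1} ... C_1),
   where C_k is braid p (k - 1).  The summand for k below is C_{d-1} ... C_{k+1}, which moves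
   the factor at position k to the end.  As all C_k are local, the S_{d-1} of the recursion
   acts on tensors of degree d as S_{d-1} (x) id. *)

definition move_to_end_sum ::
  "(nat \<Rightarrow> nat \<Rightarrow> 'a::field) \<Rightarrow> nat \<Rightarrow> (nat list \<Rightarrow> 'a) \<Rightarrow> nat list \<Rightarrow> 'a" where
  "move_to_end_sum p d f = (\<lambda>w. \<Sum>k<d. fold (braid p) [k..<d - 1] f w)"

primrec quantum_symmetrizer ::
  "(nat \<Rightarrow> nat \<Rightarrow> 'a::field) \<Rightarrow> nat \<Rightarrow> (nat list \<Rightarrow> 'a) \<Rightarrow> nat list \<Rightarrow> 'a" where
  "quantum_symmetrizer p 0 f = f"
| "quantum_symmetrizer p (Suc d) f = quantum_symmetrizer p d (move_to_end_sum p (Suc d) f)"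

definition homogeneous_part :: "nat \<Rightarrow> (nat list \<Rightarrow> 'a::field) \<Rightarrow> nat list \<Rightarrow> 'a" where
  "homogeneous_part d f = (\<lambda>w. if length w = d then f w else 0)"

(* The direct sum over d of the kernels of the S_d on the d-th tensor power of V. *)

definition nichols_ideal :: "nat \<Rightarrow> (nat \<Rightarrow> nat \<Rightarrow> 'a::field) \<Rightarrow> (nat list \<Rightarrow> 'a) set" where
  "nichols_ideal n p = {f \<in> carrier (tensor_algebra n).
     \<forall>d. quantum_symmetrizer p d (homogeneous_part d f) = (\<lambda>w. 0)}"

definition nichols_algebra ::
  "nat \<Rightarrow> (nat \<Rightarrow> nat \<Rightarrow> 'a::field) \<Rightarrow> (nat list \<Rightarrow> 'a) set ring" where
  "nichols_algebra n p = tensor_algebra n Quot nichols_ideal n p"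

definition nichols_gen ::
  "nat \<Rightarrow> (nat \<Rightarrow> nat \<Rightarrow> 'a::field) \<Rightarrow> nat \<Rightarrow> (nat list \<Rightarrow> 'a) set" where
  "nichols_gen n p i = nichols_ideal n p +>\<^bsub>tensor_algebra n\<^esub> basis_tensor [i]"

(* Note the order: [x, y]^- = y x - x y. *)

definition comm_minus :: "('b, 'c) ring_scheme \<Rightarrow> 'b \<Rightarrow> 'b \<Rightarrow> 'b" where
  "comm_minus R x y = (y \<otimes>\<^bsub>R\<^esub> x) \<ominus>\<^bsub>R\<^esub> (x \<otimes>\<^bsub>R\<^esub> y)"

primrec lbar ::
  "nat \<Rightarrow> (nat \<Rightarrow> nat \<Rightarrow> 'a::field) \<Rightarrow> nat \<Rightarrow> nat \<Rightarrow> nat \<Rightarrow> (nat list \<Rightarrow> 'a) set" where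
  "lbar n p i 0 j = nichols_gen n p j"
| "lbar n p i (Suc m) j =
     comm_minus (nichols_algebra n p) (nichols_gen n p i) (lbar n p i m j)"

(* The value 0 encodes infinite order. *)

definition mult_ord :: "'a::field \<Rightarrow> nat" where
  "mult_ord q = (if \<exists>k>0. q ^ k = 1 then (LEAST k. k > 0 \<and> q ^ k = 1) else 0)"

(* The minimum is over a nonempty set whenever q = p i i is not 1 and has finite order; for
   q = 1 no value of m_val satisfies m_val p i j < mult_ord q - 1. *)

definition m_val :: "(nat \<Rightarrow> nat \<Rightarrow> 'a::field) \<Rightarrow> nat \<Rightarrow> nat \<Rightarrow> nat" where
  "m_val p i j =
     (LEAST m. p i i ^ m * p i j * p j i = 1 \<or> (p i i ^ Suc m = 1 \<and> p i i \<noteq> 1))"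

(* With q = p_11, r = p_12 this is alpha_{m,l}^i, with q = p_22, r = p_21 it is its barred
   variant; it is total in m and l, the bounds on the indices are imposed where it is used. *)

primrec alpha :: "'a::field \<Rightarrow> 'a \<Rightarrow> nat \<Rightarrow> nat \<Rightarrow> nat \<Rightarrow> 'a" where
  "alpha q r l 0 m = (q ^ m * r - 1) ^ (mult_ord q + l)"
| "alpha q r l (Suc i) m = alpha q r l i m - inverse (q ^ i) * alpha q r l i (Suc m)"

end

theory Submission
  imports Defs
begin

text \<open>Write \<open>q = p\<^sub>i\<^sub>i\<close>, \<open>r = p\<^sub>i\<^sub>j\<close>, \<open>N\<close> for the order of \<open>q\<close> and \<open>M = m\<^sub>i\<^sub>j\<close>, where \<open>{i, j} = {1, 2}\<close>.

  Reading off the last letter turns the quantum symmetrizer into an iteration of skew derivations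
  (\<open>quantum_symmetrizer_append\<close>). So an element of the tensor algebra is zero in the Nichols algebra
  if and only if its constant term is zero and all its skew derivatives are zero there
  (\<open>radical_iff\<close>). The Leibniz rule shows that the radical so described is an ideal, and hence that
  the iterated commutators may be computed with representatives in the tensor algebra
  (\<open>lbar_eq_zero_iff\<close>).

  Let \<open>z\<^sub>0 = x\<^sub>j\<close> and \<open>z\<^sub>k\<^sub>+\<^sub>1 = x\<^sub>i z\<^sub>k - q\<^sup>k r z\<^sub>k x\<^sub>i\<close> be the iterated braided commutators. Computing their derivatives gives
  that \<open>z\<^sub>k x\<^sub>i\<^sup>a\<close> vanishes in the Nichols algebra if \<open>k > M\<close> or \<open>a \<ge> N\<close>, and that the remaining ones are linearly
  independent (\<open>combination_in_radical_iff\<close>). On the other hand, the ordinary commutator with \<open>x\<^sub>i\<close> maps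
  \<open>z\<^sub>k x\<^sub>i\<^sup>a\<close> to minus \<open>z\<^sub>k\<^sub>+\<^sub>1 x\<^sub>i\<^sup>a + t\<^sub>k z\<^sub>k x\<^sub>i\<^sup>a\<^sup>+\<^sup>1\<close> with \<open>t\<^sub>k = q\<^sup>k r - 1\<close>. By this recursion the coefficient of \<open>z\<^sub>k x\<^sub>i\<^sup>m\<^sup>-\<^sup>k\<close> in the
  \<open>m\<close>-fold commutator is, up to sign, the divided difference of the power function \<open>x\<^sup>m\<close> at the nodes
  \<open>t\<^sub>0, \<dots>, t\<^sub>k\<close> (\<open>iterated_comm_eq\<close>).

  So the \<open>m\<close>-fold commutator vanishes if and only if these divided differences vanish for all \<open>k \<le> m\<close> with
  \<open>m - N < k \<le> M\<close>. For \<open>m \<ge> M + N\<close> no such \<open>k\<close> exists. For \<open>m < N\<close> the condition includes \<open>k = 0\<close> and \<open>k = 1\<close>, or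
  else \<open>k = m\<close>, and cannot hold. For \<open>m = N + l\<close> it says that the polynomial interpolating \<open>x\<^sup>m\<close> at
  \<open>t\<^sub>0, \<dots>, t\<^sub>M\<close> has degree at most \<open>l\<close>; equivalently, the divided differences of order \<open>l + 1\<close> over
  consecutive nodes vanish (\<open>pow_ddiff_tail_iff\<close>), and the scalars \<open>alpha\<close> are nonzero multiples
  of these (\<open>alpha_eq_pow_ddiff\<close>).\<close>

section \<open>The tensor algebra\<close>

text \<open>The product of the tensor algebra, for arbitrary coefficient functions: the recursion on words below
  replaces \<open>f\<close> by the shifted function \<open>\<lambda>u. f (a # u)\<close>.\<close>

definition tmul :: "(nat list \<Rightarrow> 'a::field) \<Rightarrow> (nat list \<Rightarrow> 'a) \<Rightarrow> nat list \<Rightarrow> 'a" where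
  "tmul f g w = (\<Sum>k\<le>length w. f (take k w) * g (drop k w))"

lemma tmul_Nil [simp]: "tmul f g [] = f [] * g []"
  by (simp add: tmul_def)

text \<open>Splitting off the first letter: either the first factor contributes the empty word, or it takes
  that letter. This turns identities between products into inductions on words.\<close>

lemma tmul_Cons [simp]: "tmul f g (a # w) = f [] * g (a # w) + tmul (\<lambda>u. f (a # u)) g w"
  unfolding tmul_def length_Cons sum.atMost_Suc_shift by simp

lemma tmul_sum_left:
  "tmul (\<lambda>w. \<Sum>k\<in>A. c k * f k w) g = (\<lambda>w. \<Sum>k\<in>A. c k * tmul (f k) g w)"
  unfolding fun_eq_iff tmul_def sum_distrib_left sum_distrib_right
  by (intro allI, subst sum.swap) (simp add: mult_ac)

lemma tmul_sum_right:
  "tmul g (\<lambda>w. \<Sum>k\<in>A. c k * f k w) = (\<lambda>w. \<Sum>k\<in>A. c k * tmul g (f k) w)"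
  unfolding fun_eq_iff tmul_def sum_distrib_left sum_distrib_right
  by (intro allI, subst sum.swap) (simp add: mult_ac)

lemma tmul_add_left: "tmul (\<lambda>w. f w + f' w) g = (\<lambda>w. tmul f g w + tmul f' g w)"
  by (simp add: tmul_def algebra_simps sum.distrib fun_eq_iff)

lemma tmul_add_right: "tmul g (\<lambda>w. f w + f' w) = (\<lambda>w. tmul g f w + tmul g f' w)"
  by (simp add: tmul_def algebra_simps sum.distrib fun_eq_iff)

lemma tmul_diff_left: "tmul (\<lambda>w. f w - f' w) g = (\<lambda>w. tmul f g w - tmul f' g w)"
  by (simp add: tmul_def algebra_simps sum_subtractf fun_eq_iff)

lemma tmul_diff_right: "tmul g (\<lambda>w. f w - f' w) = (\<lambda>w. tmul g f w - tmul g f' w)"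
  by (simp add: tmul_def algebra_simps sum_subtractf fun_eq_iff)

lemma tmul_scale_left: "tmul (\<lambda>w. c * f w) g = (\<lambda>w. c * tmul f g w)"
  by (simp add: tmul_def sum_distrib_left mult_ac fun_eq_iff)

lemma tmul_scale_right: "tmul g (\<lambda>w. c * f w) = (\<lambda>w. c * tmul g f w)"
  by (simp add: tmul_def sum_distrib_left mult_ac fun_eq_iff)

lemma tmul_zero_left [simp]: "tmul (\<lambda>w. 0) g = (\<lambda>w. 0)"
  and tmul_zero_right [simp]: "tmul g (\<lambda>w. 0) = (\<lambda>w. 0)"
  by (simp_all add: tmul_def fun_eq_iff)

lemmas tmul_linear = tmul_add_left tmul_add_right tmul_diff_left tmul_diff_right
  tmul_scale_left tmul_scale_right

lemma tmul_assoc: "tmul (tmul f g) h = tmul f (tmul g h)"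
proof
  show "tmul (tmul f g) h w = tmul f (tmul g h) w" for w
    by (induction w arbitrary: f) (simp_all add: tmul_linear algebra_simps)
qed

lemma tmul_basis_Nil_left [simp]: "tmul (basis_tensor []) f = f"
proof
  show "tmul (basis_tensor []) f w = f w" for w
    by (cases w) (simp_all add: basis_tensor_def)
qed

lemma tmul_basis_Nil_right [simp]: "tmul f (basis_tensor []) = f"
proof
  show "tmul f (basis_tensor []) w = f w" for w
    by (induction w arbitrary: f) (simp_all add: basis_tensor_def)
qed

lemma mult_tensor_algebra: "f \<otimes>\<^bsub>tensor_algebra n\<^esub> g = tmul f g"
  by (simp add: tensor_algebra_def tmul_def fun_eq_iff)

lemma tmul_basis_tensor: "tmul (basis_tensor u) (basis_tensor v) = basis_tensor (u @ v)"
  using mult_basis_tensor[where n = 0] by (simp add: mult_tensor_algebra)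

lemma carrier_tensor_algebra:
  "f \<in> carrier (tensor_algebra n) \<longleftrightarrow> finite {w. f w \<noteq> 0} \<and> (\<forall>w. f w \<noteq> 0 \<longrightarrow> w \<in> lists {1..n})"
  by (auto simp: tensor_algebra_def)

lemma basis_tensor_carrier:
  "u \<in> lists {1..n} \<Longrightarrow> basis_tensor u \<in> carrier (tensor_algebra n)"
  by (auto simp: carrier_tensor_algebra basis_tensor_def)

lemma tmul_carrier:
  assumes "f \<in> carrier (tensor_algebra n)" "g \<in> carrier (tensor_algebra n)"
  shows "tmul f g \<in> carrier (tensor_algebra n)"
proof -
  have support: "\<exists>u v. w = u @ v \<and> f u \<noteq> 0 \<and> g v \<noteq> 0" if "tmul f g w \<noteq> 0" for w
  proof -
    from that obtain k where "f (take k w) * g (drop k w) \<noteq> 0"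
      unfolding tmul_def by (meson sum.neutral)
    then show ?thesis
      by (intro exI[of _ "take k w"] exI[of _ "drop k w"]) auto
  qed
  then have "{w. tmul f g w \<noteq> 0} \<subseteq> (\<lambda>(u, v). u @ v) ` ({u. f u \<noteq> 0} \<times> {v. g v \<noteq> 0})"
    by fast
  moreover have "finite ((\<lambda>(u, v). u @ v) ` ({u. f u \<noteq> 0} \<times> {v. g v \<noteq> 0}))"
    using assms by (intro finite_imageI finite_cartesian_product) (simp_all add: carrier_tensor_algebra)
  ultimately have "finite {w. tmul f g w \<noteq> 0}"
    by (rule finite_subset)
  moreover have "w \<in> lists {1..n}" if "tmul f g w \<noteq> 0" for w
    using support[OF that] assms unfolding carrier_tensor_algebra by fastforce
  ultimately show ?thesis
    by (simp add: carrier_tensor_algebra)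
qed

lemma combination_carrier:
  assumes "f \<in> carrier (tensor_algebra n)" "g \<in> carrier (tensor_algebra n)"
  shows "(\<lambda>w. c * f w + d * g w) \<in> carrier (tensor_algebra n)"
proof -
  have "finite {w. c * f w + d * g w \<noteq> 0}"
    by (rule finite_subset[of _ "{w. f w \<noteq> 0} \<union> {w. g w \<noteq> 0}"])
       (use assms in \<open>auto simp: carrier_tensor_algebra\<close>)
  moreover have "w \<in> lists {1..n}" if "c * f w + d * g w \<noteq> 0" for w
    using that assms unfolding carrier_tensor_algebra by (cases "f w = 0") auto
  ultimately show ?thesis
    by (simp add: carrier_tensor_algebra)
qed

lemma ring_tensor_algebra: "ring (tensor_algebra n :: (nat list \<Rightarrow> 'a::field) ring)"
proof (rule ringI)
  let ?T = "tensor_algebra n :: (nat list \<Rightarrow> 'a) ring"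
  have ops: "f \<oplus>\<^bsub>?T\<^esub> g = (\<lambda>w. f w + g w)" "\<zero>\<^bsub>?T\<^esub> = (\<lambda>w. 0)" "\<one>\<^bsub>?T\<^esub> = basis_tensor []" for f g
    by (simp_all add: tensor_algebra_def basis_tensor_def fun_eq_iff)
  show "abelian_group ?T"
  proof (rule abelian_groupI)
    fix f assume f: "f \<in> carrier ?T"
    show "\<exists>g\<in>carrier ?T. g \<oplus>\<^bsub>?T\<^esub> f = \<zero>\<^bsub>?T\<^esub>"
      by (rule bexI[of _ "\<lambda>w. - f w"]) (use combination_carrier[OF f f, of "-1" 0] in \<open>simp_all add: ops\<close>)
  qed (use combination_carrier[of _ n _ 1 1] in \<open>auto simp: ops add_ac carrier_tensor_algebra\<close>)
  show "monoid ?T"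
    by (rule monoidI)
       (simp_all add: ops mult_tensor_algebra tmul_carrier tmul_assoc basis_tensor_carrier)
  show "(f \<oplus>\<^bsub>?T\<^esub> g) \<otimes>\<^bsub>?T\<^esub> h = f \<otimes>\<^bsub>?T\<^esub> h \<oplus>\<^bsub>?T\<^esub> g \<otimes>\<^bsub>?T\<^esub> h"
    "h \<otimes>\<^bsub>?T\<^esub> (f \<oplus>\<^bsub>?T\<^esub> g) = h \<otimes>\<^bsub>?T\<^esub> f \<oplus>\<^bsub>?T\<^esub> h \<otimes>\<^bsub>?T\<^esub> g" for f g h
    by (simp_all add: ops mult_tensor_algebra tmul_linear fun_eq_iff)
qed

lemma minus_tensor_algebra:
  fixes f g :: "nat list \<Rightarrow> 'a::field"
  assumes "f \<in> carrier (tensor_algebra n)" "g \<in> carrier (tensor_algebra n)"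
  shows "f \<ominus>\<^bsub>tensor_algebra n\<^esub> g = (\<lambda>w. f w - g w)"
proof -
  interpret ring "tensor_algebra n :: (nat list \<Rightarrow> 'a) ring"
    by (rule ring_tensor_algebra)
  have "\<ominus>\<^bsub>tensor_algebra n\<^esub> g = (\<lambda>w. - g w)"
    by (rule minus_equality)
       (use assms combination_carrier[OF assms(2,2), of "-1" 0] in \<open>simp_all add: tensor_algebra_def\<close>)
  then show ?thesis
    by (simp add: a_minus_def) (simp add: tensor_algebra_def)
qed

section \<open>Skew derivations\<close>

text \<open>The scalar produced when the braiding moves \<open>x\<^sub>i\<close> from the left of the word \<open>w\<close> to its right.\<close>

definition crossing_factor :: "(nat \<Rightarrow> nat \<Rightarrow> 'a::field) \<Rightarrow> nat \<Rightarrow> nat list \<Rightarrow> 'a" where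
  "crossing_factor p i w = prod_list (map (p i) w)"

lemma crossing_factor_simps [simp]:
  "crossing_factor p i [] = 1" "crossing_factor p i (a # w) = p i a * crossing_factor p i w"
  "crossing_factor p i (u @ v) = crossing_factor p i u * crossing_factor p i v"
  by (simp_all add: crossing_factor_def)

text \<open>The diagonal automorphism \<open>x\<^sub>k \<mapsto> p\<^sub>i\<^sub>k x\<^sub>k\<close> of the tensor algebra.\<close>

definition twist :: "(nat \<Rightarrow> nat \<Rightarrow> 'a::field) \<Rightarrow> nat \<Rightarrow> (nat list \<Rightarrow> 'a) \<Rightarrow> nat list \<Rightarrow> 'a" where
  "twist p i f w = crossing_factor p i w * f w"

text \<open>The component with last letter \<open>i\<close> of the map that moves one tensor factor to the end through the
  braiding, summed over all factors. On words, \<open>x\<^sub>i\<close> is deleted in turn at each of its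
  occurrences and weighted by the letters to the right of it; the coefficient at \<open>w\<close> thus collects
  the words that arise from \<open>w\<close> by inserting \<open>i\<close>.\<close>

definition skew_der ::
  "(nat \<Rightarrow> nat \<Rightarrow> 'a::field) \<Rightarrow> nat \<Rightarrow> (nat list \<Rightarrow> 'a) \<Rightarrow> nat list \<Rightarrow> 'a" where
  "skew_der p i f w = (\<Sum>k\<le>length w. crossing_factor p i (drop k w) * f (take k w @ i # drop k w))"

lemma skew_der_Nil [simp]: "skew_der p i f [] = f [i]"
  by (simp add: skew_der_def)

lemma skew_der_Cons [simp]:
  "skew_der p i f (a # w) = crossing_factor p i (a # w) * f (i # a # w) + skew_der p i (\<lambda>u. f (a # u)) w"
  unfolding skew_der_def length_Cons sum.atMost_Suc_shift by simp

lemma skew_der_combination: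
  "skew_der p i (\<lambda>w. c * f w + d * g w) = (\<lambda>w. c * skew_der p i f w + d * skew_der p i g w)"
  by (simp add: skew_der_def algebra_simps sum.distrib sum_distrib_left fun_eq_iff)

lemma skew_der_sum:
  "skew_der p i (\<lambda>w. \<Sum>k\<in>A. c k * f k w) = (\<lambda>w. \<Sum>k\<in>A. c k * skew_der p i (f k) w)"
  unfolding fun_eq_iff skew_der_def sum_distrib_left sum_distrib_right
  by (intro allI, subst sum.swap) (simp add: mult_ac)

lemma skew_der_add: "skew_der p i (\<lambda>w. f w + g w) = (\<lambda>w. skew_der p i f w + skew_der p i g w)"
  using skew_der_combination[of p i 1 f 1 g] by simp

lemma skew_der_scale: "skew_der p i (\<lambda>w. c * f w) = (\<lambda>w. c * skew_der p i f w)"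
  using skew_der_combination[of p i c f 0 f] by simp

lemma twist_tmul: "twist p i (tmul f g) = tmul (twist p i f) (twist p i g)"
proof
  show "twist p i (tmul f g) w = tmul (twist p i f) (twist p i g) w" for w
  proof (induction w arbitrary: f)
    case (Cons a w)
    have "(\<lambda>u. twist p i f (a # u)) = (\<lambda>u. p i a * twist p i (\<lambda>u. f (a # u)) u)"
      by (simp add: twist_def mult_ac fun_eq_iff)
    moreover have "twist p i (tmul f g) (a # w)
        = twist p i f [] * twist p i g (a # w) + p i a * twist p i (tmul (\<lambda>u. f (a # u)) g) w"
      by (simp add: twist_def algebra_simps)
    ultimately show ?case
      by (simp add: tmul_scale_left Cons)
  qed (simp add: twist_def)
qed

text \<open>The twisted Leibniz rule: an \<open>x\<^sub>i\<close> that is moved out of the first factor also crosses the whole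
  second factor, and the twist records the price of that crossing.\<close>

lemma skew_der_tmul:
  "skew_der p i (tmul f g) = (\<lambda>w. tmul f (skew_der p i g) w + tmul (skew_der p i f) (twist p i g) w)"
proof
  show "skew_der p i (tmul f g) w = tmul f (skew_der p i g) w + tmul (skew_der p i f) (twist p i g) w" for w
  proof (induction w arbitrary: f g)
    case Nil
    then show ?case by (simp add: twist_def algebra_simps)
  next
    case (Cons a w)
    let ?fa = "\<lambda>u. f (a # u)" and ?ga = "\<lambda>u. g (a # u)" and ?fia = "\<lambda>u. f (i # a # u)"
    have "skew_der p i (\<lambda>u. tmul f g (a # u)) w
        = f [] * skew_der p i ?ga w + skew_der p i (tmul ?fa g) w"
      by (simp add: skew_der_add skew_der_scale)
    moreover have "(\<lambda>u. skew_der p i f (a # u))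
        = (\<lambda>u. p i a * twist p i ?fia u + skew_der p i ?fa u)"
      by (simp add: twist_def mult_ac fun_eq_iff)
    moreover have "tmul (twist p i ?fia) (twist p i g) w = crossing_factor p i w * tmul ?fia g w"
      by (simp flip: twist_tmul) (simp add: twist_def)
    ultimately show ?case
      by (simp add: Cons tmul_add_left tmul_scale_left) (simp add: twist_def algebra_simps)
  qed
qed

lemma skew_der_twist: "skew_der p i (twist p j f) = (\<lambda>w. p j i * twist p j (skew_der p i f) w)"
proof
  fix w
  have eq: "twist p j f (take k w @ i # drop k w) = p j i * crossing_factor p j w * f (take k w @ i # drop k w)" for k
  proof -
    have "crossing_factor p j (drop k w) * crossing_factor p j (take k w) = crossing_factor p j w"
      by (metis append_take_drop_id crossing_factor_simps(3) mult.commute)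
    then have "crossing_factor p j (take k w @ i # drop k w) = p j i * crossing_factor p j w"
      by (simp add: mult.left_commute mult.commute)
    then show ?thesis by (simp add: twist_def)
  qed
  show "skew_der p i (twist p j f) w = p j i * twist p j (skew_der p i f) w"
    unfolding twist_def[of p j "skew_der p i f"] skew_der_def eq sum_distrib_left
    by (simp add: mult_ac)
qed

section \<open>The Nichols ideal as a radical\<close>

text \<open>Deleting the letters of \<open>w\<close> from the last to the first. Up to the identification of a word with the
  corresponding element of the dual tensor algebra this is the canonical pairing whose radical is the
  Nichols ideal.\<close>

definition pairing :: "(nat \<Rightarrow> nat \<Rightarrow> 'a::field) \<Rightarrow> nat list \<Rightarrow> (nat list \<Rightarrow> 'a) \<Rightarrow> 'a" where
  "pairing p w f = foldr (skew_der p) w f []"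

lemma pairing_Nil [simp]: "pairing p [] f = f []"
  and pairing_snoc [simp]: "pairing p (w @ [i]) f = pairing p w (skew_der p i f)"
  by (simp_all add: pairing_def)

lemma pairing_combination:
  "pairing p w (\<lambda>w. c * f w + d * g w) = c * pairing p w f + d * pairing p w g"
  by (induction w arbitrary: f g rule: rev_induct) (simp_all add: skew_der_combination)

lemma pairing_cong:
  assumes "\<And>u. length u = length w \<Longrightarrow> f u = g u"
  shows "pairing p w f = pairing p w g"
  using assms
proof (induction w arbitrary: f g rule: rev_induct)
  case (snoc i w)
  have "pairing p w (skew_der p i f) = pairing p w (skew_der p i g)"
    by (rule snoc.IH) (auto simp: skew_der_def intro!: sum.cong snoc.prems)
  then show ?case by simp
qed simp

lemma pairing_twist: "pairing p w (twist p i f) = crossing_factor p i w * pairing p w f"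
proof (induction w arbitrary: f rule: rev_induct)
  case (snoc j w)
  have "pairing p w (skew_der p j (twist p i f)) = p i j * pairing p w (twist p i (skew_der p j f))"
    using pairing_combination[of p w "p i j" "twist p i (skew_der p j f)" 0 "\<lambda>w. 0"]
    by (simp add: skew_der_twist)
  then show ?case by (simp add: snoc)
qed (simp add: twist_def)

text \<open>One summand of the map that moves a factor to the end, evaluated at a word that ends in \<open>i\<close>. The
  trailing word \<open>v\<close> is not touched by these braidings; it is there so that the induction can peel off
  the letters of \<open>u\<close> from the right.\<close>

lemma fold_braid:
  "k \<le> length u \<Longrightarrow> fold (braid p) [k..<length u] f (u @ i # v)
     = crossing_factor p i (drop k u) * f (take k u @ i # drop k u @ v)"
proof (induction u arbitrary: v rule: rev_induct)
  case (snoc a u)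
  show ?case
  proof (cases "k = length (u @ [a])")
    case False
    with snoc.prems have k: "k \<le> length u" by simp
    have swap: "swap_letters (length u) (u @ a # i # v) = u @ i # a # v"
      by (simp add: swap_letters_def nth_append list_update_append)
    from k have "fold (braid p) [k..<length (u @ [a])] f ((u @ [a]) @ i # v)
        = braid p (length u) (fold (braid p) [k..<length u] f) (u @ a # i # v)"
      by simp
    also have "\<dots> = p i a * fold (braid p) [k..<length u] f (u @ i # a # v)"
      by (simp add: braid_def swap nth_append)
    finally show ?thesis
      using k by (simp add: snoc.IH)
  qed simp
qed simp

text \<open>The factorization of the quantum symmetrizer, read from the outside in, strips one letter after the
  other off the end of \<open>w\<close>, and each such step is a skew derivation. As the lower symmetrizers act on the
  first tensor factors only, the rest \<open>v\<close> of the word is a parameter.\<close>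

lemma quantum_symmetrizer_append:
  "quantum_symmetrizer p (length w) f (w @ v) = pairing p w (\<lambda>u. f (u @ v))"
proof (induction w arbitrary: f v rule: rev_induct)
  case (snoc i w)
  have "quantum_symmetrizer p (length (w @ [i])) f ((w @ [i]) @ v)
      = pairing p w (\<lambda>u. move_to_end_sum p (Suc (length w)) f (u @ i # v))"
    using snoc[of "move_to_end_sum p (Suc (length w)) f" "i # v"] by simp
  also have "\<dots> = pairing p w (skew_der p i (\<lambda>u. f (u @ v)))"
  proof (rule pairing_cong)
    fix u :: "nat list" assume "length u = length w"
    then show "move_to_end_sum p (Suc (length w)) f (u @ i # v) = skew_der p i (\<lambda>u. f (u @ v)) u"
      by (auto simp: move_to_end_sum_def skew_der_def lessThan_Suc_atMost fold_braid
          simp flip: \<open>length u = length w\<close> intro!: sum.cong)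
  qed
  finally show ?case by simp
qed simp

lemma quantum_symmetrizer_eq_0:
  assumes "\<And>w. length w = e \<Longrightarrow> f w = 0" "length w = e"
  shows "quantum_symmetrizer p d f w = 0"
  using assms
proof (induction d arbitrary: f w)
  case (Suc d)
  have fold: "fold (braid p) ks g w = 0"
    if "\<And>w. length w = e \<Longrightarrow> g w = 0" "length w = e" for ks g w
    using that
  proof (induction ks arbitrary: g)
    case (Cons k ks)
    have "braid p k g u = 0" if "length u = e" for u
      using Cons.prems(1) that by (simp add: braid_def swap_letters_def)
    then show ?case
      using Cons.IH Cons.prems(2) by simp
  qed simp
  have "move_to_end_sum p (Suc d) f w = 0" if "length w = e" for w
    using fold[of f w] Suc.prems(1) that by (simp add: move_to_end_sum_def)
  then show ?case
    using Suc.IH Suc.prems(2) by simp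
qed simp

lemma nichols_ideal_iff:
  "f \<in> nichols_ideal n p \<longleftrightarrow> f \<in> carrier (tensor_algebra n) \<and> (\<forall>w. pairing p w f = 0)"
proof -
  have "quantum_symmetrizer p d (homogeneous_part d f) w
      = (if length w = d then pairing p w f else 0)" for d w
  proof (cases "length w = d")
    case True
    then have "quantum_symmetrizer p d (homogeneous_part d f) w = pairing p w (homogeneous_part d f)"
      using quantum_symmetrizer_append[of p w "homogeneous_part d f" "[]"] by simp
    also have "\<dots> = pairing p w f"
      using True by (intro pairing_cong) (simp add: homogeneous_part_def)
    finally show ?thesis using True by simp
  next
    case False
    then show ?thesis
      using quantum_symmetrizer_eq_0[of "length w" "homogeneous_part d f" w]
      by (simp add: homogeneous_part_def)
  qed
  then show ?thesis
    by (auto simp: nichols_ideal_def fun_eq_iff)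
qed

definition radical :: "(nat \<Rightarrow> nat \<Rightarrow> 'a::field) \<Rightarrow> (nat list \<Rightarrow> 'a) set" where
  "radical p = {f. \<forall>w. pairing p w f = 0}"

text \<open>Membership in the radical is tested by the skew derivations, each of which lowers the degree by
  one. All arguments below about vanishing in the Nichols algebra use this criterion.\<close>

lemma radical_iff: "f \<in> radical p \<longleftrightarrow> f [] = 0 \<and> (\<forall>i. skew_der p i f \<in> radical p)"
proof -
  have "(\<forall>w. pairing p w f = 0) \<longleftrightarrow> f [] = 0 \<and> (\<forall>i w. pairing p (w @ [i]) f = 0)"
    by (metis pairing_Nil rev_exhaust)
  then show ?thesis by (simp add: radical_def)
qed

lemma radical_combination:
  "f \<in> radical p \<Longrightarrow> g \<in> radical p \<Longrightarrow> (\<lambda>w. c * f w + d * g w) \<in> radical p"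
  by (simp add: radical_def pairing_combination)

lemma radical_zero: "(\<lambda>w. 0) \<in> radical p"
  using pairing_combination[of p _ 0 "\<lambda>w. 0" 0 "\<lambda>w. 0"] by (simp add: radical_def)

lemma radical_scale: "f \<in> radical p \<Longrightarrow> (\<lambda>w. c * f w) \<in> radical p"
  using radical_combination[of f p f c 0] by simp

lemma radical_sum:
  "(\<And>k. k \<in> A \<Longrightarrow> f k \<in> radical p) \<Longrightarrow> (\<lambda>w. \<Sum>k\<in>A. c k * f k w) \<in> radical p"
proof (induction A rule: infinite_finite_induct)
  case (insert k A)
  then show ?case
    using radical_combination[of "f k" p "\<lambda>w. \<Sum>k\<in>A. c k * f k w" "c k" 1] by simp
qed (simp_all add: radical_zero)

text \<open>By the Leibniz rule, all terms of a derivative of a product with a factor \<open>f\<close> in the radical again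
  contain \<open>f\<close>, a twist of \<open>f\<close> or a derivative of \<open>f\<close>, and these three stay in the radical.\<close>

lemma radical_tmul:
  assumes "f \<in> radical p"
  shows "tmul g f \<in> radical p" "tmul f g \<in> radical p"
proof -
  have twist: "twist p i f \<in> radical p" if "f \<in> radical p" for i f
    using that by (simp add: radical_def pairing_twist)
  have "pairing p w (tmul g f) = 0 \<and> pairing p w (tmul f g) = 0" for w
    using assms
  proof (induction w arbitrary: f g rule: rev_induct)
    case (snoc i w)
    have "skew_der p i f \<in> radical p"
      using snoc.prems radical_iff by blast
    then have "pairing p w (tmul g (skew_der p i f)) = 0"
      "pairing p w (tmul (skew_der p i f) (twist p i g)) = 0"
      "pairing p w (tmul (skew_der p i g) (twist p i f)) = 0"
      "pairing p w (tmul f (skew_der p i g)) = 0"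
      using snoc.IH twist[OF snoc.prems] snoc.prems by blast+
    then show ?case
      using pairing_combination[of p w 1 _ 1] by (simp add: skew_der_tmul)
  qed (use radical_iff in auto)
  then show "tmul g f \<in> radical p" "tmul f g \<in> radical p"
    by (simp_all add: radical_def)
qed

lemma nichols_ideal_eq: "nichols_ideal n p = carrier (tensor_algebra n) \<inter> radical p"
  by (auto simp: nichols_ideal_iff radical_def)

lemma ideal_nichols_ideal: "ideal (nichols_ideal n p) (tensor_algebra n)"
proof -
  let ?T = "tensor_algebra n" and ?I = "nichols_ideal n p"
  interpret ring ?T by (rule ring_tensor_algebra)
  show ?thesis
  proof (rule idealI)
    have zero: "\<zero>\<^bsub>?T\<^esub> \<in> ?I"
      using radical_zero[of p] zero_closed by (simp add: nichols_ideal_eq) (simp add: tensor_algebra_def)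
    show "subgroup ?I (add_monoid ?T)"
    proof (rule group.subgroupI)
      show "group (add_monoid ?T)" by (rule a_group)
      show "?I \<subseteq> carrier (add_monoid ?T)" by (simp add: nichols_ideal_eq)
      show "?I \<noteq> {}" using zero by blast
    next
      fix f assume f: "f \<in> ?I"
      then have "\<ominus>\<^bsub>?T\<^esub> f = (\<lambda>w. (-1) * f w)"
        using minus_tensor_algebra[of "\<lambda>w. 0" n f] zero_closed
        by (simp add: nichols_ideal_eq a_minus_def)  (simp add: tensor_algebra_def)
      moreover have "\<ominus>\<^bsub>?T\<^esub> f \<in> carrier ?T"
        using f by (simp add: nichols_ideal_eq)
      ultimately have "\<ominus>\<^bsub>?T\<^esub> f \<in> ?I"
        using f radical_scale[of f p "-1"] by (simp add: nichols_ideal_eq)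
      then show "inv\<^bsub>add_monoid ?T\<^esub> f \<in> ?I" by (simp add: a_inv_def)
    next
      fix f g assume "f \<in> ?I" "g \<in> ?I"
      then show "f \<otimes>\<^bsub>add_monoid ?T\<^esub> g \<in> ?I"
        using radical_combination[of f p g 1 1] combination_carrier[of f n g 1 1]
        by (simp add: nichols_ideal_eq) (simp add: tensor_algebra_def)
    qed
  qed (use radical_tmul tmul_carrier ring_axioms in \<open>auto simp: nichols_ideal_eq mult_tensor_algebra\<close>)
qed

text \<open>Representatives in the tensor algebra of the iterated commutators of the Nichols algebra.\<close>

primrec iterated_comm :: "nat \<Rightarrow> nat \<Rightarrow> nat \<Rightarrow> nat list \<Rightarrow> 'a::field" where
  "iterated_comm i j 0 = basis_tensor [j]"
| "iterated_comm i j (Suc m) = (\<lambda>w. tmul (iterated_comm i j m) (basis_tensor [i]) w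
     - tmul (basis_tensor [i]) (iterated_comm i j m) w)"

lemma lbar_eq_zero_iff:
  fixes p :: "nat \<Rightarrow> nat \<Rightarrow> 'a::field"
  assumes "i \<in> {1..n}" "j \<in> {1..n}"
  shows "lbar n p i m j = \<zero>\<^bsub>nichols_algebra n p\<^esub> \<longleftrightarrow> iterated_comm i j m \<in> radical p"
proof -
  let ?T = "tensor_algebra n :: (nat list \<Rightarrow> 'a) ring" and ?I = "nichols_ideal n p"
  interpret ideal ?I ?T by (rule ideal_nichols_ideal)
  let ?Q = "?T Quot ?I" and ?h = "a_r_coset ?T ?I"
  interpret h: ring_hom_ring ?T ?Q ?h by (rule rcos_ring_hom_ring)
  have gen: "basis_tensor [i] \<in> carrier ?T" "basis_tensor [j] \<in> carrier ?T"
    using assms by (simp_all add: basis_tensor_carrier)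
  have "iterated_comm i j m \<in> carrier ?T \<and> lbar n p i m j = ?h (iterated_comm i j m)" for m
  proof (induction m)
    case 0
    then show ?case using gen by (simp add: nichols_gen_def)
  next
    case (Suc m)
    let ?x = "basis_tensor [i]" and ?y = "iterated_comm i j m"
    have closed: "?y \<otimes>\<^bsub>?T\<^esub> ?x \<in> carrier ?T" "?x \<otimes>\<^bsub>?T\<^esub> ?y \<in> carrier ?T"
      using Suc gen by (intro m_closed; blast)+
    have "iterated_comm i j (Suc m) = ?y \<otimes>\<^bsub>?T\<^esub> ?x \<ominus>\<^bsub>?T\<^esub> ?x \<otimes>\<^bsub>?T\<^esub> ?y"
      by (simp add: minus_tensor_algebra[OF closed]) (simp add: mult_tensor_algebra)
    moreover have "lbar n p i (Suc m) j = ?h (?y \<otimes>\<^bsub>?T\<^esub> ?x \<ominus>\<^bsub>?T\<^esub> ?x \<otimes>\<^bsub>?T\<^esub> ?y)"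
      using Suc gen closed
      by (simp add: comm_minus_def nichols_algebra_def nichols_gen_def a_minus_def)
    ultimately show ?case using closed by simp
  qed
  then have carrier: "iterated_comm i j m \<in> carrier ?T"
    and lbar: "lbar n p i m j = ?h (iterated_comm i j m)"
    by blast+
  have "?h (iterated_comm i j m) = \<zero>\<^bsub>?Q\<^esub> \<longleftrightarrow> iterated_comm i j m \<in> ?I"
    using a_rcos_const rcos_const_imp_mem[OF carrier] unfolding FactRing_def ring.simps by blast
  then show ?thesis
    using carrier by (simp add: lbar nichols_algebra_def nichols_ideal_eq)
qed

section \<open>Divided differences of powers\<close>

definition q_int :: "'a::field \<Rightarrow> nat \<Rightarrow> 'a" where
  "q_int q a = (\<Sum>k<a. q ^ k)"

lemma q_int_0 [simp]: "q_int q 0 = 0"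
  by (simp add: q_int_def)

lemma q_int_Suc: "q_int q (Suc a) = 1 + q * q_int q a"
  unfolding q_int_def sum.lessThan_Suc_shift by (simp add: sum_distrib_left)

lemma q_int_eq: "(q - 1) * q_int q a = q ^ a - 1"
  unfolding q_int_def by (rule power_diff_1_eq [symmetric])

text \<open>The divided difference of the function \<open>x \<mapsto> x\<^sup>m\<close> at the nodes \<open>t 0, \<dots>, t k\<close>, that is, the complete
  homogeneous symmetric polynomial of degree \<open>m - k\<close> in these nodes. The recursion used here remains
  meaningful for coinciding nodes, and it is the rule by which the coefficients of the iterated
  commutators arise.\<close>

primrec pow_ddiff :: "(nat \<Rightarrow> 'a::field) \<Rightarrow> nat \<Rightarrow> nat \<Rightarrow> 'a" where
  "pow_ddiff t 0 k = of_bool (k = 0)"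
| "pow_ddiff t (Suc m) k = (case k of 0 \<Rightarrow> 0 | Suc k' \<Rightarrow> pow_ddiff t m k') + t k * pow_ddiff t m k"

lemma pow_ddiff_eq_0: "m < k \<Longrightarrow> pow_ddiff t m k = 0"
  by (induction m arbitrary: k) (auto split: nat.split)

lemma pow_ddiff_diag: "pow_ddiff t m m = 1"
  by (induction m) (simp_all add: pow_ddiff_eq_0)

lemma pow_ddiff_0: "pow_ddiff t m 0 = t 0 ^ m"
  by (induction m) simp_all

text \<open>The classical recursion for divided differences, with the denominator cleared.\<close>

lemma pow_ddiff_shift:
  "pow_ddiff (\<lambda>i. t (Suc i)) m k - pow_ddiff t m k = (t (Suc k) - t 0) * pow_ddiff t m (Suc k)"
proof (induction m arbitrary: k)
  case (Suc m)
  let ?d = "pow_ddiff t m" and ?e = "pow_ddiff (\<lambda>i. t (Suc i)) m"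
  have e: "?e k = ?d k + (t (Suc k) - t 0) * ?d (Suc k)" for k
    using Suc[of k] by (simp add: algebra_simps)
  show ?case
    by (cases k) (simp_all add: e algebra_simps)
qed simp

lemma pow_ddiff_shift':
  "pow_ddiff (\<lambda>i. t (Suc a + i)) m k - pow_ddiff (\<lambda>i. t (a + i)) m k
     = (t (Suc (a + k)) - t a) * pow_ddiff (\<lambda>i. t (a + i)) m (Suc k)"
  using pow_ddiff_shift[of "\<lambda>i. t (a + i)" m k] by simp

text \<open>Both sides say that the polynomial interpolating \<open>x\<^sup>m\<close> at \<open>t 0, \<dots>, t M\<close> has degree at most \<open>l\<close>: on
  the left its Newton coefficients beyond \<open>l\<close> vanish, on the right the divided differences of order
  \<open>l + 1\<close> over all blocks of \<open>l + 2\<close> consecutive nodes do. The proof moves from one to the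
  other by the recursion for divided differences, dividing by differences of nodes.\<close>

lemma pow_ddiff_tail_iff:
  assumes distinct: "\<And>a b. a < b \<Longrightarrow> b \<le> M \<Longrightarrow> t a \<noteq> t b" and "l < M"
  shows "(\<forall>k. l < k \<and> k \<le> M \<longrightarrow> pow_ddiff t m k = 0) \<longleftrightarrow>
         (\<forall>a \<le> M - l - 1. pow_ddiff (\<lambda>i. t (a + i)) m (l + 1) = 0)"
proof -
  let ?d = "\<lambda>a. pow_ddiff (\<lambda>i. t (a + i)) m"
  have difference: "?d (Suc a) k - ?d a k = (t (Suc (a + k)) - t a) * ?d a (Suc k)" for a k
    by (rule pow_ddiff_shift')
  show ?thesis
  proof safe
    fix a assume tail: "\<forall>k. l < k \<and> k \<le> M \<longrightarrow> pow_ddiff t m k = 0" and "a \<le> M - l - 1"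
    have "?d a k = 0" if "l < k" "a + k \<le> M" for a k
      using that
    proof (induction a arbitrary: k)
      case 0
      then show ?case using tail by simp
    next
      case (Suc a)
      then have "?d a k = 0" "?d a (Suc k) = 0" by simp_all
      then show ?case using difference[of a k] by simp
    qed
    then show "?d a (l + 1) = 0"
      using \<open>a \<le> M - l - 1\<close> \<open>l < M\<close> by simp
  next
    fix k assume base: "\<forall>a \<le> M - l - 1. ?d a (l + 1) = 0" and k: "l < k" "k \<le> M"
    have "?d a k = 0" if "l + 1 \<le> k" "a + k \<le> M" for a k
      using that
    proof (induction k arbitrary: a rule: dec_induct)
      case base
      then show ?case using \<open>\<forall>a \<le> M - l - 1. ?d a (l + 1) = 0\<close> by simp
    next
      case (step k)
      then have "?d a k = 0" "?d (Suc a) k = 0"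
        using step.IH[of a] step.IH[of "Suc a"] by simp_all
      then have "(t (Suc (a + k)) - t a) * ?d a (Suc k) = 0"
        using difference[of a k] by simp
      moreover have "t a \<noteq> t (Suc (a + k))"
        using step.prems by (intro distinct) simp_all
      ultimately show ?case by simp
    qed
    from this[of k 0] k show "pow_ddiff t m k = 0" by simp
  qed
qed

text \<open>The recursion for \<open>alpha\<close> is the one for divided differences at the nodes \<open>q\<^sup>i r - 1\<close>, up to scaling.
  The node difference \<open>q\<^sup>a r (q\<^sup>k - 1)\<close> depends on \<open>a\<close> through \<open>q\<^sup>a\<close> only; this is why the factors
  \<open>inverse (q\<^sup>i)\<close> make the scalars match at each stage.\<close>

lemma alpha_eq_pow_ddiff:
  fixes q r :: "'a::field"
  assumes "q \<noteq> 0"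
  defines "t \<equiv> \<lambda>i. q ^ i * r - 1"
  shows "alpha q r l i a = q ^ (i * a) * (\<Prod>k=1..i. r * (1 - q ^ k))
     * pow_ddiff (\<lambda>j. t (a + j)) (mult_ord q + l) i"
proof (induction i arbitrary: a)
  case 0
  then show ?case by (simp add: pow_ddiff_0 t_def)
next
  case (Suc i)
  let ?c = "\<Prod>k=1..i. r * (1 - q ^ k)" and ?d = "\<lambda>a. pow_ddiff (\<lambda>j. t (a + j)) (mult_ord q + l)"
  have "inverse (q ^ i) * q ^ (i * Suc a) = q ^ (i * a)"
    using \<open>q \<noteq> 0\<close> by (simp add: power_add field_simps)
  then have "inverse (q ^ i) * (q ^ (i * Suc a) * ?c * y) = q ^ (i * a) * ?c * y" for y
    by (metis mult.assoc)
  then have "alpha q r l (Suc i) a = q ^ (i * a) * ?c * (?d a i - ?d (Suc a) i)"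
    by (simp only: alpha.simps Suc.IH right_diff_distrib)
  also have "?d a i - ?d (Suc a) i = q ^ a * (r * (1 - q ^ Suc i)) * ?d a (Suc i)"
    using pow_ddiff_shift'[of t a "mult_ord q + l" i]
    by (simp add: t_def power_add algebra_simps)
  finally show ?case
    by (simp add: power_add mult_ac)
qed

section \<open>Braided commutators in degree one in the second letter\<close>

locale braided_pair =
  fixes p :: "nat \<Rightarrow> nat \<Rightarrow> 'a::field" and i j :: nat
  assumes neq: "i \<noteq> j"
begin

definition x_pow :: "nat \<Rightarrow> nat list \<Rightarrow> 'a" where
  "x_pow a = basis_tensor (replicate a i)"

text \<open>The iterated braided commutators of \<open>x\<^sub>i\<close> with \<open>x\<^sub>j\<close>. The scalar is chosen so that the skew
  derivation by \<open>x\<^sub>i\<close> kills them.\<close>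

primrec z :: "nat \<Rightarrow> nat list \<Rightarrow> 'a" where
  "z 0 = basis_tensor [j]"
| "z (Suc k) = (\<lambda>w. tmul (basis_tensor [i]) (z k) w - p i i ^ k * p i j * tmul (z k) (basis_tensor [i]) w)"

lemma x_pow_0 [simp]: "x_pow 0 = basis_tensor []"
  and tmul_x_pow: "tmul (x_pow a) (basis_tensor [i]) = x_pow (Suc a)"
  and tmul_x_pow': "tmul (basis_tensor [i]) (x_pow a) = x_pow (Suc a)"
  by (simp_all add: x_pow_def tmul_basis_tensor replicate_append_same)

lemma x_pow_Nil: "x_pow a [] = of_bool (a = 0)"
  by (simp add: x_pow_def basis_tensor_def)

lemma twist_basis: "twist p h (basis_tensor [k]) = (\<lambda>w. p h k * basis_tensor [k] w)"
  by (auto simp: twist_def basis_tensor_def)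

lemma skew_der_basis:
  "skew_der p h (basis_tensor [k]) = (\<lambda>w. of_bool (h = k) * basis_tensor [] w)"
proof
  show "skew_der p h (basis_tensor [k]) w = of_bool (h = k) * basis_tensor [] w" for w
    by (cases w) (auto simp: skew_der_def basis_tensor_def intro!: sum.neutral dest!: arg_cong[where f = length])
qed

lemma skew_der_one [simp]: "skew_der p h (basis_tensor []) = (\<lambda>w. 0)"
  by (simp add: skew_der_def basis_tensor_def fun_eq_iff)

lemma skew_der_x_pow:
  "skew_der p h (x_pow a) = (\<lambda>w. of_bool (h = i) * q_int (p i i) a * x_pow (a - 1) w)"
proof (induction a)
  case 0
  show ?case
    by simp
next
  case (Suc a)
  have "tmul (skew_der p h (x_pow a)) (basis_tensor [i]) = (\<lambda>w. of_bool (h = i) * q_int (p i i) a * x_pow a w)"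
    unfolding Suc by (cases a) (simp_all add: tmul_scale_left tmul_x_pow fun_eq_iff)
  then show ?case
    by (simp add: skew_der_tmul skew_der_basis twist_basis tmul_scale_right q_int_Suc fun_eq_iff algebra_simps
        flip: tmul_x_pow[of a])
qed

lemma twist_z: "twist p h (z k) = (\<lambda>w. p h i ^ k * p h j * z k w)"
proof (induction k)
  case (Suc k)
  have "twist p h (\<lambda>w. f w - c * g w) = (\<lambda>w. twist p h f w - c * twist p h g w)" for f g c
    by (simp add: twist_def algebra_simps fun_eq_iff)
  then show ?case
    by (simp add: twist_tmul Suc twist_basis tmul_linear) (simp add: fun_eq_iff algebra_simps)
qed (simp add: twist_basis)

definition z_coeff :: "nat \<Rightarrow> 'a" where
  "z_coeff k = (\<Prod>e<k. 1 - p i i ^ e * p i j * p j i)"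

text \<open>The two contributions to the derivative by \<open>x\<^sub>i\<close> cancel, and the derivative by \<open>x\<^sub>j\<close> picks up the
  factor \<open>1 - p\<^sub>i\<^sub>i\<^sup>k p\<^sub>i\<^sub>j p\<^sub>j\<^sub>i\<close> in passing from \<open>z k\<close> to \<open>z (k + 1)\<close>.\<close>

lemma skew_der_z:
  "skew_der p h (z k) = (\<lambda>w. of_bool (h = j) * z_coeff k * x_pow k w)"
proof (induction k)
  case 0
  show ?case by (simp add: skew_der_basis z_coeff_def)
next
  case (Suc k)
  have diff: "skew_der p h (\<lambda>w. f w - c * g w) = (\<lambda>w. skew_der p h f w - c * skew_der p h g w)" for f g c
    using skew_der_combination[of p h 1 f "-c" g] by simp
  have left: "skew_der p h (tmul (basis_tensor [i]) (z k))
      = (\<lambda>w. of_bool (h = j) * z_coeff k * x_pow (Suc k) w + of_bool (h = i) * p i i ^ k * p i j * z k w)"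
    using neq by (auto simp: skew_der_tmul Suc skew_der_basis twist_z tmul_linear tmul_x_pow' fun_eq_iff)
  have right: "skew_der p h (tmul (z k) (basis_tensor [i]))
      = (\<lambda>w. of_bool (h = i) * z k w + of_bool (h = j) * p j i * z_coeff k * x_pow (Suc k) w)"
    using neq by (auto simp: skew_der_tmul Suc skew_der_basis twist_basis tmul_linear tmul_x_pow fun_eq_iff)
  have z_coeff: "z_coeff (Suc k) = z_coeff k * (1 - p i i ^ k * p i j * p j i)"
    by (simp add: z_coeff_def)
  show ?case
    unfolding z.simps diff left right z_coeff using neq by (auto simp: fun_eq_iff algebra_simps)
qed

declare z.simps(2) [simp del]

lemma skew_der_z_x_pow:
  "skew_der p i (tmul (z k) (x_pow a)) = (\<lambda>w. q_int (p i i) a * tmul (z k) (x_pow (a - 1)) w)"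
  using neq by (simp add: skew_der_tmul skew_der_z skew_der_x_pow tmul_scale_right)

text \<open>Taking an ordinary instead of a braided commutator of \<open>z k x\<^sub>i\<^sup>a\<close> with \<open>x\<^sub>i\<close> gives \<open>z (k + 1) x\<^sub>i\<^sup>a\<close> plus
  \<open>p\<^sub>i\<^sub>i\<^sup>k p\<^sub>i\<^sub>j - 1\<close> times \<open>z k x\<^sub>i\<^sup>a\<^sup>+\<^sup>1\<close>, up to sign. So the coefficients obey the recursion that defines the divided
  differences of powers at the nodes \<open>p\<^sub>i\<^sub>i\<^sup>k p\<^sub>i\<^sub>j - 1\<close>.\<close>

lemma iterated_comm_eq:
  "iterated_comm i j m = (\<lambda>w. \<Sum>k\<le>m. (-1) ^ m * pow_ddiff (\<lambda>k. p i i ^ k * p i j - 1) m k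
     * tmul (z k) (x_pow (m - k)) w)"
proof (induction m)
  case 0
  show ?case by simp
next
  case (Suc m)
  let ?t = "\<lambda>k. p i i ^ k * p i j - 1"
  let ?b = "\<lambda>k a. tmul (z k) (x_pow a)"
  show ?case
  proof
    fix w
    have comm: "tmul (?b k a) (basis_tensor [i]) w - tmul (basis_tensor [i]) (?b k a) w
        = - ?b (Suc k) a w - ?t k * ?b k (Suc a) w" for k a
    proof -
      have "tmul (basis_tensor [i]) (z k)
          = (\<lambda>w. z (Suc k) w + p i i ^ k * p i j * tmul (z k) (basis_tensor [i]) w)"
        by (simp add: z.simps)
      then have "tmul (basis_tensor [i]) (?b k a)
          = (\<lambda>w. ?b (Suc k) a w + p i i ^ k * p i j * ?b k (Suc a) w)"
        by (simp add: tmul_linear tmul_assoc tmul_x_pow' flip: tmul_assoc[of "basis_tensor [i]"])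
      then show ?thesis
        by (simp add: tmul_assoc tmul_x_pow algebra_simps)
    qed
    have "iterated_comm i j (Suc m) w
      = (\<Sum>k\<le>m. (-1) ^ m * pow_ddiff ?t m k
          * (tmul (?b k (m - k)) (basis_tensor [i]) w - tmul (basis_tensor [i]) (?b k (m - k)) w))"
      by (simp add: Suc tmul_sum_left tmul_sum_right right_diff_distrib sum_subtractf del: tmul_Cons)
    also have "\<dots> = (\<Sum>k\<le>m. (-1) ^ Suc m * pow_ddiff ?t m k * ?b (Suc k) (m - k) w)
        + (\<Sum>k\<le>m. (-1) ^ Suc m * (?t k * pow_ddiff ?t m k) * ?b k (Suc m - k) w)"
      unfolding comm sum.distrib[symmetric]
      by (intro sum.cong) (simp_all add: Suc_diff_le algebra_simps)
    also have "(\<Sum>k\<le>m. (-1) ^ Suc m * pow_ddiff ?t m k * ?b (Suc k) (m - k) w)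
        = (\<Sum>k\<le>Suc m. (-1) ^ Suc m * (case k of 0 \<Rightarrow> 0 | Suc k' \<Rightarrow> pow_ddiff ?t m k') * ?b k (Suc m - k) w)"
      by (subst sum.atMost_Suc_shift) simp
    also have "(\<Sum>k\<le>m. (-1) ^ Suc m * (?t k * pow_ddiff ?t m k) * ?b k (Suc m - k) w)
        = (\<Sum>k\<le>Suc m. (-1) ^ Suc m * (?t k * pow_ddiff ?t m k) * ?b k (Suc m - k) w)"
      by (simp add: pow_ddiff_eq_0)
    finally show "iterated_comm i j (Suc m) w
        = (\<Sum>k\<le>Suc m. (-1) ^ Suc m * pow_ddiff ?t (Suc m) k * ?b k (Suc m - k) w)"
      by (simp only: sum.distrib[symmetric] pow_ddiff.simps distrib_left distrib_right)
  qed
qed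

end

section \<open>Vanishing of the iterated commutators\<close>

text \<open>The number \<open>N\<close> is the order of \<open>p\<^sub>i\<^sub>i\<close>, and \<open>M\<close> is minus the entry at \<open>i, j\<close> of the generalized Cartan matrix.\<close>

locale cartan_pair = braided_pair +
  fixes M N :: nat
  assumes order: "p i i ^ N = 1" "\<And>a. 0 < a \<Longrightarrow> a < N \<Longrightarrow> p i i ^ a \<noteq> 1"
    and cartan: "p i i ^ M * p i j * p j i = 1" "\<And>a. a < M \<Longrightarrow> p i i ^ a * p i j * p j i \<noteq> 1"
    and M_pos: "0 < M" and M_less: "M + 1 < N"
begin

lemma q_neq_1: "p i i \<noteq> 1"
  using order(2)[of 1] M_less by simp

lemma nonzero: "p i i \<noteq> 0" "p i j \<noteq> 0"
  using cartan(1) M_pos by (auto simp: power_0_left)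

lemma q_int_eq_0_iff: "0 < a \<Longrightarrow> a \<le> N \<Longrightarrow> q_int (p i i) a = 0 \<longleftrightarrow> a = N"
  using q_int_eq[of "p i i" a] q_neq_1 order(1) order(2)[of a]
  by (metis eq_iff_diff_eq_0 le_neq_implies_less mult_eq_0_iff)

lemma x_pow_in_radical: "N \<le> a \<Longrightarrow> x_pow a \<in> radical p"
proof (induction a rule: dec_induct)
  case base
  have "skew_der p h (x_pow N) = (\<lambda>w. 0)" for h
    using q_int_eq_0_iff[of N] M_less by (simp add: skew_der_x_pow)
  then show ?case
    using M_less by (subst radical_iff) (simp add: x_pow_Nil radical_zero)
next
  case (step a)
  then show ?case
    by (metis radical_tmul(2) tmul_x_pow)
qed

lemma x_pow_notin_radical: "a < N \<Longrightarrow> x_pow a \<notin> radical p"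
proof (induction a)
  case 0
  show ?case by (subst radical_iff) (simp add: basis_tensor_def)
next
  case (Suc a)
  show ?case
  proof
    let ?c = "q_int (p i i) (Suc a)"
    assume "x_pow (Suc a) \<in> radical p"
    then have "skew_der p i (x_pow (Suc a)) \<in> radical p"
      using radical_iff by blast
    then have "(\<lambda>w. ?c * x_pow a w) \<in> radical p"
      by (simp add: skew_der_x_pow)
    from radical_scale[OF this, of "inverse ?c"] have "x_pow a \<in> radical p"
      using q_int_eq_0_iff[of "Suc a"] Suc.prems by (simp flip: mult.assoc)
    with Suc show False by simp
  qed
qed

lemma z_coeff_eq_0_iff: "z_coeff k = 0 \<longleftrightarrow> M < k"
proof -
  have "z_coeff k = 0 \<longleftrightarrow> (\<exists>e<k. p i i ^ e * p i j * p j i = 1)"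
    by (auto simp: z_coeff_def)
  also have "\<dots> \<longleftrightarrow> M < k"
    using cartan by (metis linorder_neqE_nat order.strict_trans)
  finally show ?thesis .
qed

lemma z_Nil: "z k [] = 0"
  by (cases k) (simp_all add: z.simps basis_tensor_def)

lemma z_in_radical: "M < k \<Longrightarrow> z k \<in> radical p"
  using z_coeff_eq_0_iff[of k] by (subst radical_iff) (simp add: z_Nil skew_der_z radical_zero)

lemma z_notin_radical:
  assumes "k \<le> M"
  shows "z k \<notin> radical p"
proof
  assume "z k \<in> radical p"
  then have "skew_der p j (z k) \<in> radical p"
    using radical_iff by blast
  then have "(\<lambda>w. z_coeff k * x_pow k w) \<in> radical p"
    by (simp add: skew_der_z)
  from radical_scale[OF this, of "inverse (z_coeff k)"] have "x_pow k \<in> radical p"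
    using assms z_coeff_eq_0_iff[of k] by (simp flip: mult.assoc)
  then show False
    using x_pow_notin_radical[of k] assms M_less by simp
qed

text \<open>In the Nichols algebra the elements \<open>z k x\<^sub>i\<^sup>a\<close> with \<open>k \<le> M\<close> and \<open>a < N\<close> are linearly independent, and those
  outside this range vanish. Independence is shown by induction on the degree: the derivative
  by \<open>x\<^sub>i\<close> multiplies the coefficient of \<open>z k x\<^sub>i\<^sup>a\<close> by the \<open>q\<close>-integer of \<open>a\<close>, which is nonzero
  for \<open>0 < a < N\<close>, and lowers \<open>a\<close> by one; so it detects all coefficients except that of \<open>z m\<close>, which is then isolated.\<close>

lemma combination_in_radical_iff:
  "(\<lambda>w. \<Sum>k\<le>m. c k * tmul (z k) (x_pow (m - k)) w) \<in> radical p \<longleftrightarrow>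
     (\<forall>k. k \<le> M \<longrightarrow> k \<le> m \<longrightarrow> m < N + k \<longrightarrow> c k = 0)"
proof -
  have outside: "tmul (z k) (x_pow (m - k)) \<in> radical p"
    if "M < k \<or> (N + k \<le> m)" for k m
    using that
  proof
    assume "M < k"
    then show ?thesis by (intro radical_tmul(2) z_in_radical)
  next
    assume "N + k \<le> m"
    then show ?thesis by (intro radical_tmul(1) x_pow_in_radical) simp
  qed
  show ?thesis
  proof
    assume zero: "\<forall>k. k \<le> M \<longrightarrow> k \<le> m \<longrightarrow> m < N + k \<longrightarrow> c k = 0"
    \<comment> \<open>The indices of the terms that vanish in the Nichols algebra.\<close>
    let ?K = "{k. k \<le> m \<and> (M < k \<or> N + k \<le> m)}"
    have "(\<Sum>k\<le>m. c k * tmul (z k) (x_pow (m - k)) w)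
        = (\<Sum>k\<in>?K. c k * tmul (z k) (x_pow (m - k)) w)" for w
      using zero by (intro sum.mono_neutral_right) (auto simp: not_less not_le)
    moreover have "(\<lambda>w. \<Sum>k\<in>?K. c k * tmul (z k) (x_pow (m - k)) w) \<in> radical p"
      using outside by (intro radical_sum) simp
    ultimately show "(\<lambda>w. \<Sum>k\<le>m. c k * tmul (z k) (x_pow (m - k)) w) \<in> radical p"
      by simp
  next
    assume "(\<lambda>w. \<Sum>k\<le>m. c k * tmul (z k) (x_pow (m - k)) w) \<in> radical p"
    then show "\<forall>k. k \<le> M \<longrightarrow> k \<le> m \<longrightarrow> m < N + k \<longrightarrow> c k = 0"
    proof (induction m arbitrary: c)
      case 0
      have "c 0 = 0"
      proof (rule ccontr)
        assume "c 0 \<noteq> 0"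
        moreover have "(\<lambda>w. c 0 * z 0 w) \<in> radical p"
          using 0 by simp
        from radical_scale[OF this, of "inverse (c 0)"] have "z 0 \<in> radical p"
          using \<open>c 0 \<noteq> 0\<close> by (simp flip: mult.assoc)
        then show False using z_notin_radical[of 0] by simp
      qed
      then show ?case by simp
    next
      case (Suc m)
      let ?f = "\<lambda>w. \<Sum>k\<le>Suc m. c k * tmul (z k) (x_pow (Suc m - k)) w"
      have "skew_der p i ?f \<in> radical p"
        using Suc.prems radical_iff by blast
      \<comment> \<open>The summand for \<open>k = m + 1\<close> drops out, as its power of \<open>x\<^sub>i\<close> is the empty one.\<close>
      moreover have "skew_der p i ?f
          = (\<lambda>w. \<Sum>k\<le>m. (c k * q_int (p i i) (Suc m - k)) * tmul (z k) (x_pow (m - k)) w)"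
        unfolding skew_der_sum skew_der_z_x_pow by (rule ext) (simp add: mult.assoc)
      ultimately have "\<forall>k. k \<le> M \<longrightarrow> k \<le> m \<longrightarrow> m < N + k \<longrightarrow> c k * q_int (p i i) (Suc m - k) = 0"
        using Suc.IH[of "\<lambda>k. c k * q_int (p i i) (Suc m - k)"] by simp
      then have lower: "c k = 0" if "k \<le> M" "k \<le> m" "Suc m < N + k" for k
        using that q_int_eq_0_iff[of "Suc m - k"] by fastforce
      \<comment> \<open>With the lower coefficients gone, only a multiple of \<open>z (m + 1)\<close> is left.\<close>
      have top: "c (Suc m) = 0" if "Suc m \<le> M"
      proof (rule ccontr)
        assume "c (Suc m) \<noteq> 0"
        have "?f = (\<lambda>w. c (Suc m) * z (Suc m) w)"
          using lower that M_less by (intro ext) simp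
        with Suc.prems have "(\<lambda>w. c (Suc m) * z (Suc m) w) \<in> radical p"
          by simp
        from radical_scale[OF this, of "inverse (c (Suc m))"] have "z (Suc m) \<in> radical p"
          using \<open>c (Suc m) \<noteq> 0\<close> by (simp flip: mult.assoc)
        then show False using z_notin_radical[OF that] by blast
      qed
      show ?case
        using lower top by (metis le_Suc_eq)
    qed
  qed
qed

abbreviation node :: "nat \<Rightarrow> 'a" where
  "node k \<equiv> p i i ^ k * p i j - 1"

lemma iterated_comm_in_radical_iff:
  "iterated_comm i j m \<in> radical p \<longleftrightarrow>
     (\<forall>k. k \<le> M \<longrightarrow> k \<le> m \<longrightarrow> m < N + k \<longrightarrow> pow_ddiff node m k = 0)"
  unfolding iterated_comm_eq combination_in_radical_iff by simp

lemma node_distinct: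
  assumes "a < b" "b < N"
  shows "node a \<noteq> node b"
proof
  assume "node a = node b"
  then have "p i i ^ a = p i i ^ b"
    using nonzero by simp
  also have "\<dots> = p i i ^ a * p i i ^ (b - a)"
    using assms by (simp flip: power_add)
  finally have "p i i ^ a = p i i ^ a * p i i ^ (b - a)" .
  then show False
    using nonzero order(2)[of "b - a"] assms by simp
qed

lemma iterated_comm_high: "M + N \<le> m \<Longrightarrow> iterated_comm i j m \<in> radical p"
  by (simp add: iterated_comm_in_radical_iff)

text \<open>Otherwise the Newton coefficients of \<open>x\<^sup>m\<close> with index at most \<open>M\<close> and \<open>m\<close> would vanish.
  If \<open>m \<le> M\<close>, the last one is 1; if \<open>m > M\<close>, the first two force \<open>x\<^sup>m\<close> to vanish at two distinct nodes.\<close>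

lemma iterated_comm_low:
  assumes "m < N"
  shows "iterated_comm i j m \<notin> radical p"
proof
  assume "iterated_comm i j m \<in> radical p"
  then have zero: "pow_ddiff node m k = 0" if "k \<le> M" "k \<le> m" for k
    using that assms by (simp add: iterated_comm_in_radical_iff)
  show False
  proof (cases "m \<le> M")
    case True
    then show False using zero[of m] by (simp add: pow_ddiff_diag)
  next
    case False
    then have "pow_ddiff node m 0 = 0" "pow_ddiff node m 1 = 0"
      using zero M_pos by simp_all
    then have "node 0 ^ m = 0" "node 1 ^ m = 0"
      using pow_ddiff_shift[of node m 0] by (simp_all add: pow_ddiff_0)
    then have "node 0 = node 1" by simp
    then show False
      using node_distinct[of 0 1] M_less by simp
  qed
qed

text \<open>Here \<open>z k x\<^sub>i\<^sup>a\<close> with \<open>a = N + l - k\<close> survives in the Nichols algebra for \<open>l < k \<le> M\<close> only, so the condition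
  concerns the Newton coefficients beyond \<open>l\<close>, which the scalars \<open>alpha\<close> express through divided
  differences over consecutive nodes. All scaling factors are nonzero because \<open>l + 1 < N\<close>.\<close>

lemma iterated_comm_middle:
  assumes "l < M" "N = mult_ord (p i i)"
  shows "iterated_comm i j (N + l) \<in> radical p \<longleftrightarrow>
    (\<forall>k \<le> M - l - 1. alpha (p i i) (p i j) l (l + 1) k = 0)"
proof -
  have "p i j * (1 - p i i ^ k) \<noteq> 0" if "k \<in> {1..l + 1}" for k
    using that nonzero order(2)[of k] assms M_less by simp
  then have "(\<Prod>k=1..l + 1. p i j * (1 - p i i ^ k)) \<noteq> 0"
    by (meson finite_atLeastAtMost prod_zero_iff)
  then have "alpha (p i i) (p i j) l (l + 1) a = 0 \<longleftrightarrow> pow_ddiff (\<lambda>b. node (a + b)) (N + l) (l + 1) = 0" for a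
    unfolding alpha_eq_pow_ddiff[OF nonzero(1)] assms(2)[symmetric] using nonzero
    by (simp del: prod.cl_ivl_Suc)
  moreover have "iterated_comm i j (N + l) \<in> radical p \<longleftrightarrow>
      (\<forall>k. l < k \<and> k \<le> M \<longrightarrow> pow_ddiff node (N + l) k = 0)"
    using M_less by (auto simp: iterated_comm_in_radical_iff)
  moreover have "node a \<noteq> node b" if "a < b" "b \<le> M" for a b
    using that M_less by (intro node_distinct) simp_all
  ultimately show ?thesis
    using pow_ddiff_tail_iff[of M node l "N + l"] \<open>l < M\<close> by simp
qed

end

lemma mult_ord_pos:
  assumes "mult_ord q > 0"
  shows "q ^ mult_ord q = 1" "\<And>a. 0 < a \<Longrightarrow> a < mult_ord q \<Longrightarrow> q ^ a \<noteq> 1"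
proof -
  have ex: "\<exists>k>0. q ^ k = 1"
    using assms by (auto simp: mult_ord_def split: if_splits)
  then have eq: "mult_ord q = (LEAST k. k > 0 \<and> q ^ k = 1)"
    by (simp add: mult_ord_def)
  show "q ^ mult_ord q = 1"
    using LeastI_ex[OF ex] eq by simp
  show "q ^ a \<noteq> 1" if "0 < a" "a < mult_ord q" for a
    using that not_less_Least[of a "\<lambda>k. k > 0 \<and> q ^ k = 1"] eq by simp
qed

text \<open>The second alternative in the minimum that defines \<open>m_val\<close> cannot be the one attained, because the
  power \<open>m_val + 1\<close> of \<open>p\<^sub>i\<^sub>i\<close> is below the order; but it shows that the minimum is over a nonempty set.\<close>

lemma cartan_pairI:
  fixes p :: "nat \<Rightarrow> nat \<Rightarrow> 'a::field"
  assumes "i \<noteq> j" "p i j * p j i \<noteq> 1" "mult_ord (p i i) > 0" "m_val p i j < mult_ord (p i i) - 1"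
  shows "cartan_pair p i j (m_val p i j) (mult_ord (p i i))"
proof -
  let ?q = "p i i" and ?M = "m_val p i j" and ?N = "mult_ord (p i i)"
  let ?P = "\<lambda>m. ?q ^ m * p i j * p j i = 1 \<or> (?q ^ Suc m = 1 \<and> ?q \<noteq> 1)"
  note ord = mult_ord_pos[OF assms(3)]
  have small: "?q ^ Suc m \<noteq> 1" if "m \<le> ?M" for m
    using that assms(4) by (intro ord) simp_all
  have "?q ^ Suc (?N - 1) = 1" "?q \<noteq> 1"
    using ord(1) small[of 0] assms(3) by simp_all
  then have "?P (?N - 1)" by blast
  then have "?P ?M"
    unfolding m_val_def by (rule LeastI)
  with small have cartan: "?q ^ ?M * p i j * p j i = 1" by blast
  moreover have "?q ^ a * p i j * p j i \<noteq> 1" if "a < ?M" for a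
    using not_less_Least[of a ?P] that unfolding m_val_def by blast
  moreover have "0 < ?M"
    using cartan assms(2) by (cases "?M = 0") auto
  ultimately show ?thesis
    using assms(1,4) ord by unfold_locales auto
qed

theorem theorem6p8:
  fixes n :: nat
    and p :: "nat \<Rightarrow> nat \<Rightarrow> 'a::{alg_closed_field, field_char_0}"
  assumes "n \<ge> 2"
    and "\<And>i j. i \<in> {1..n} \<Longrightarrow> j \<in> {1..n} \<Longrightarrow> p i j \<noteq> 0"
    and "p 1 2 * p 2 1 \<noteq> 1"
    and "mult_ord (p 1 1) > 0" and "mult_ord (p 2 2) > 0"
    and "m_val p 1 2 < mult_ord (p 1 1) - 1"
    and "m_val p 2 1 < mult_ord (p 2 2) - 1"
  shows "(\<forall>m. m \<ge> m_val p 1 2 + mult_ord (p 1 1) \<longrightarrow>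
            lbar n p 1 m 2 = \<zero>\<^bsub>nichols_algebra n p\<^esub>)
       \<and> (\<forall>m. m \<ge> m_val p 2 1 + mult_ord (p 2 2) \<longrightarrow>
            lbar n p 2 m 1 = \<zero>\<^bsub>nichols_algebra n p\<^esub>)
       \<and> (\<forall>m. m < mult_ord (p 1 1) \<longrightarrow>
            lbar n p 1 m 2 \<noteq> \<zero>\<^bsub>nichols_algebra n p\<^esub>)
       \<and> (\<forall>m. m < mult_ord (p 2 2) \<longrightarrow>
            lbar n p 2 m 1 \<noteq> \<zero>\<^bsub>nichols_algebra n p\<^esub>)
       \<and> (\<forall>l. l < m_val p 1 2 \<longrightarrow>
            (lbar n p 1 (mult_ord (p 1 1) + l) 2 = \<zero>\<^bsub>nichols_algebra n p\<^esub>
             \<longleftrightarrow> (\<forall>k \<le> m_val p 1 2 - l - 1. alpha (p 1 1) (p 1 2) l (l + 1) k = 0)))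
       \<and> (\<forall>l. l < m_val p 2 1 \<longrightarrow>
            (lbar n p 2 (mult_ord (p 2 2) + l) 1 = \<zero>\<^bsub>nichols_algebra n p\<^esub>
             \<longleftrightarrow> (\<forall>k \<le> m_val p 2 1 - l - 1. alpha (p 2 2) (p 2 1) l (l + 1) k = 0)))"
proof -
  interpret c12: cartan_pair p 1 2 "m_val p 1 2" "mult_ord (p 1 1)"
    using assms by (intro cartan_pairI) simp_all
  interpret c21: cartan_pair p 2 1 "m_val p 2 1" "mult_ord (p 2 2)"
    using assms by (intro cartan_pairI) (simp_all add: mult.commute)
  have lbar: "lbar n p 1 m 2 = \<zero>\<^bsub>nichols_algebra n p\<^esub> \<longleftrightarrow> iterated_comm 1 2 m \<in> radical p"
    "lbar n p 2 m 1 = \<zero>\<^bsub>nichols_algebra n p\<^esub> \<longleftrightarrow> iterated_comm 2 1 m \<in> radical p" for m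
    using \<open>n \<ge> 2\<close> by (simp_all add: lbar_eq_zero_iff)
  show ?thesis
    unfolding lbar
    using c12.iterated_comm_high c12.iterated_comm_low c12.iterated_comm_middle
      c21.iterated_comm_high c21.iterated_comm_low c21.iterated_comm_middle
    by blast
qed

end
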